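(* Let $p$ be an odd prime and $n\ge k\ge 1$ integers. Assume that $\nu_p(k)\le\nu_p(n)$ and that $r=(n-k)/(p-1)$ is a nonnegative integer. Let $M$ be the maximum pole of $B_{n-k}^{(-k)}(x)$. Then the following are equivalent: (1) $S(n,k)$ is an almost minimum zero case (AMZC); (2) $S(n+1,k+1)$ is a shifted almost minimum zero case (SAMZC); (3) $\nu_p\left(\binom{r+n}{n}\right)=\sigma_p(n-k)/(p-1)-M$; (4) $\nu_p(\tau_u)=-M$, where $u$ is the partition with $u_{p-1}=r$ and all other parts zero, i.e. $\tau_u=(n-k)!\binom{-n-1}{r}/p^r$. Furthermore, if these conditions hold, then $$\nu_p(S(n+1,k+1))=\nu_p(S(n,k))=\frac{\sigma_p(k)-\sigma_p(n)}{p-1}+\nu_p\left(\binom{r+n}{n}\right).$$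
   Context: $S(n,k)$ is the Stirling number of the second kind; $\sigma_p(m)$ is the sum of the base $p$ digits of $m\ge 0$; $\nu_p$ is the $p$-adic valuation. For $s\in\mathbb Z$ and $d\ge 0$, $\binom sd=s(s-1)\cdots(s-d+1)/d!$. Higher order Bernoulli polynomials $B_m^{(l)}(x)$ ($m\ge 0$, $l\in\mathbb Z$) are defined by $\left(\frac{t}{e^t-1}\right)^l e^{tx}=\sum_{m\ge 0}B_m^{(l)}(x)\frac{t^m}{m!}$; $B_m^{(l)}(x)$ is monic of degree $m$ with rational coefficients, and $B_m^{(l)}=B_m^{(l)}(0)$. The maximum pole (with respect to $p$) of a nonzero rational polynomial is the integer $M$ such that $-M$ is the minimum of the $p$-adic valuations of its coefficients. One has $S(n,k)=\binom nk B_{n-k}^{(-k)}=\binom{n-1}{k-1}B_{n-k}^{(-k+1)}(1)$. $S(n,k)$ is an almost minimum zero case (AMZC) if $\nu_p(S(n,k))=\nu_p\left(\binom nk\right)-M$, where $M$ is the maximum pole of $B_{n-k}^{(-k)}(x)$. $S(n,k)$ is a shifted almost minimum zero case (SAMZC) if $\nu_p(S(n,k))=\nu_p\left(\binom{n-1}{k-1}\right)-M'$, where $M'$ is the maximum pole of $B_{n-k}^{(-k+1)}(x)$. *)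

theory Defs
  imports
    "HOL-Computational_Algebra.Computational_Algebra"
    "HOL-Combinatorics.Stirling"
begin

definition bernoulli_base :: "rat fps" where
  "bernoulli_base = fps_X / (fps_exp 1 - 1)"

text \<open>
  The defining identity is read in the ring of power series in \<open>t\<close> over the polynomials
  in \<open>x\<close>: the first factor is \<open>(t / (e^t - 1))^l\<close>, embedded coefficientwise as constant
  polynomials, and the second factor is \<open>e^(t x)\<close>, whose coefficient at \<open>t^i\<close> is \<open>x^i / i!\<close>.
  The power \<open>powi\<close> with negative exponent is the genuine inverse, as the base has constant
  term 1.
\<close>

definition bernoulli_gf :: "int \<Rightarrow> rat poly fps" where
  "bernoulli_gf l =
     Abs_fps (\<lambda>i. [:fps_nth (bernoulli_base powi l) i:]) * Abs_fps (\<lambda>i. monom (1 / fact i) i)"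

definition bernoulli_poly :: "int \<Rightarrow> nat \<Rightarrow> rat poly" where
  "bernoulli_poly l m = smult (fact m) (fps_nth (bernoulli_gf l) m)"

lemma poly_bernoulli_poly:
  "poly (bernoulli_poly l m) x = fact m * fps_nth (bernoulli_base powi l * fps_exp x) m"
  by (simp add: bernoulli_poly_def bernoulli_gf_def fps_mult_nth poly_sum poly_monom)

lemma bernoulli_base_mult: "bernoulli_base * (fps_exp 1 - 1) = fps_X"
proof -
  have nz: "fps_nth (fps_exp (1::rat) - 1) 1 \<noteq> 0" by simp
  have ne: "fps_exp (1::rat) - 1 \<noteq> 0" using nz by (metis fps_zero_nth)
  have "subdegree (fps_exp (1::rat) - 1) = 1"
    using nz by (intro subdegreeI) auto
  then have "fps_exp (1::rat) - 1 dvd fps_X"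
    using ne by (subst fps_dvd_iff) auto
  then show ?thesis by (simp add: bernoulli_base_def)
qed

lemma bernoulli_base_nth_0: "fps_nth bernoulli_base 0 = 1"
  using arg_cong[OF bernoulli_base_mult, of "\<lambda>f. fps_nth f 1"]
  by (simp add: fps_mult_nth)

text \<open>
  The \<open>p\<close>-adic valuation on the rationals. For naturals we use \<^const>\<open>multiplicity\<close>.
  The value at 0 is a dummy (0) and is never relied upon.
\<close>

definition rat_val :: "nat \<Rightarrow> rat \<Rightarrow> int" where
  "rat_val p q = int (multiplicity (int p) (fst (quotient_of q)))
               - int (multiplicity (int p) (snd (quotient_of q)))"

text \<open>
  Zero coefficients have infinite valuation and therefore do not enter the minimum.
\<close>

definition max_pole :: "nat \<Rightarrow> rat poly \<Rightarrow> int" where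
  "max_pole p f = - Min {rat_val p (coeff f i) | i. coeff f i \<noteq> 0}"

text \<open>
  Terms with \<open>i > m\<close> vanish for \<open>p \<ge> 2\<close>, so the sum runs over all base \<open>p\<close> digits of \<open>m\<close>.
\<close>

definition digit_sum :: "nat \<Rightarrow> nat \<Rightarrow> nat" where
  "digit_sum p m = (\<Sum>i\<le>m. m div p ^ i mod p)"

text \<open>
  Both notions are meant for \<open>n \<ge> k \<ge> 1\<close>, where the Stirling numbers and binomial
  coefficients involved are positive.
\<close>

definition AMZC :: "nat \<Rightarrow> nat \<Rightarrow> nat \<Rightarrow> bool" where
  "AMZC p n k \<longleftrightarrow>
     int (multiplicity p (Stirling n k)) =
     int (multiplicity p (n choose k)) - max_pole p (bernoulli_poly (- int k) (n - k))"

definition SAMZC :: "nat \<Rightarrow> nat \<Rightarrow> nat \<Rightarrow> bool" where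
  "SAMZC p n k \<longleftrightarrow>
     int (multiplicity p (Stirling n k)) =
     int (multiplicity p ((n - 1) choose (k - 1)))
       - max_pole p (bernoulli_poly (- int k + 1) (n - k))"

text \<open>
  The number \<open>\<tau>\<^sub>u\<close> for the partition \<open>u\<close> whose only nonzero entry is \<open>u\<^sub>p\<^sub>-\<^sub>1 = r\<close>.
\<close>

definition tau :: "nat \<Rightarrow> nat \<Rightarrow> nat \<Rightarrow> nat \<Rightarrow> rat" where
  "tau p n k r = fact (n - k) * ((- of_nat n - 1) gchoose r) / of_nat p ^ r"

end

theory Submission
  imports Defs
begin

text \<open>
  Put \<open>N = n - k\<close> and \<open>L = log (1 + z) / z\<close>. In the basis of the falling factorials of \<open>x - 1\<close>, the
  coefficient of \<open>B_N^(-k)(x)\<close> at \<open>(x - 1)_(N - j)\<close> is \<open>D_j = N! / (N - j)! [z^j] L^(-n-1)\<close>. This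
  basis change is unitriangular over the integers, so \<open>-M\<close> is the least valuation of the \<open>D_j\<close>. Split
  off the only essential polar term of \<open>L\<close>, namely \<open>L = G + z^(p-1) / p\<close>, and expand
  \<open>L^(-n-1) = \<Sum>\<^sub>i binom(-n-1, i) (z^(p-1) / p)^i G^(-n-1-i)\<close>. Then \<open>D_j\<close> is a combination of the terms
  \<open>t\<^sub>i = N! / (N - i(p-1))! binom(-n-1, i) / p^i\<close>, \<open>i \<le> r\<close>, whose coefficients are \<open>p\<close>-integral because
  \<open>a! [z^a] G^(-m)\<close> is. Looking at the first \<open>t\<^sub>i\<close> of minimal valuation \<open>e\<close> gives \<open>M = -e\<close>.

  Near the top degree all other contributions vanish modulo \<open>p^(e+1)\<close>: either \<open>p\<close> divides the
  coefficient, or the coefficient is divisible by \<open>n + 1 + i\<close> and \<open>(n + 1 + i) t\<^sub>i\<close> is a \<open>p\<close>-integral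
  multiple of \<open>p t\<^sub>(\<^sub>i\<^sub>+\<^sub>1\<^sub>)\<close>. Hence \<open>D_(N - b) \<equiv> 0\<close> for \<open>0 < b < p\<close> and \<open>D_N \<equiv> t\<^sub>r = \<tau>\<^sub>u\<close>. Since
  \<open>B_N^(-k)(1) = D_N\<close> and \<open>B_N^(-k)(0) = \<Sum>\<^sub>b (-1)^b b! D_(N - b)\<close>, both values are congruent to
  \<open>\<tau>\<^sub>u\<close>; they equal \<open>S(n+1, k+1) / binom(n, k)\<close> and \<open>S(n, k) / binom(n, k)\<close>, and Legendre's formula
  does the rest.
\<close>

subsection \<open>The \<open>p\<close>-adic valuation on the rationals\<close>

text \<open>\<open>quotient_of\<close> returns lowest terms; cross-multiplication shows that every
  representation of the fraction gives the same difference of multiplicities.\<close>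

lemma rat_val_fraction:
  assumes "prime p" "a \<noteq> 0" "b \<noteq> 0"
  shows "rat_val p (of_int a / of_int b) =
    int (multiplicity (int p) a) - int (multiplicity (int p) b)"
proof -
  obtain c d where cd: "quotient_of (of_int a / of_int b) = (c, d)" by force
  have q: "of_int a / of_int b = (of_int c / of_int d :: rat)" and "d > 0"
    using cd by (rule quotient_of_div, rule quotient_of_denom_pos)
  with assms have "of_int (a * d) = (of_int (c * b) :: rat)" by (simp add: field_simps)
  then have eq: "a * d = c * b" by (simp only: of_int_eq_iff)
  then have "c \<noteq> 0" using assms \<open>d > 0\<close> by auto
  have "prime_elem (int p)" using assms by auto
  then have "multiplicity (int p) a + multiplicity (int p) d =
      multiplicity (int p) c + multiplicity (int p) b"
    using arg_cong[OF eq, of "multiplicity (int p)"] assms \<open>c \<noteq> 0\<close> \<open>d > 0\<close>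
    by (simp add: prime_elem_multiplicity_mult_distrib)
  then show ?thesis by (simp add: rat_val_def cd)
qed

lemma rat_val_of_int:
  assumes "prime p"
  shows "rat_val p (of_int a) = int (multiplicity (int p) a)"
  using rat_val_fraction[OF assms, of a 1] by (cases "a = 0") (auto simp: rat_val_def)

lemma multiplicity_int:
  assumes "prime p"
  shows "multiplicity (int p) (int a) = multiplicity p a"
proof (cases "a = 0")
  case False
  show ?thesis
  proof (rule multiplicity_eqI)
    show "int p ^ multiplicity p a dvd int a"
      using multiplicity_dvd[of p a] by (metis of_nat_dvd_iff of_nat_power)
    have "\<not> p ^ Suc (multiplicity p a) dvd a"
      using False assms not_prime_unit[of p] by (subst power_dvd_iff_le_multiplicity) auto
    then show "\<not> int p ^ Suc (multiplicity p a) dvd int a"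
      unfolding of_nat_power[symmetric] of_nat_dvd_iff .
  qed
qed auto

lemma rat_val_of_nat:
  assumes "prime p"
  shows "rat_val p (of_nat a) = int (multiplicity p a)"
  using rat_val_of_int[OF assms, of "int a"] assms by (simp add: multiplicity_int)

lemma rat_fractionE:
  fixes x :: rat
  obtains a b where "x = of_int a / of_int b" "b \<noteq> 0"
  by (metis quotient_of_div quotient_of_denom_pos surj_pair less_irrefl)

lemma rat_val_mult:
  assumes "prime p" "x \<noteq> 0" "y \<noteq> 0"
  shows "rat_val p (x * y) = rat_val p x + rat_val p y"
proof -
  obtain a b where x: "x = of_int a / of_int b" "b \<noteq> 0" by (rule rat_fractionE)
  obtain c d where y: "y = of_int c / of_int d" "d \<noteq> 0" by (rule rat_fractionE)
  have "a \<noteq> 0" "c \<noteq> 0" using x y assms by auto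
  moreover have "x * y = of_int (a * c) / of_int (b * d)" using x y by simp
  moreover have "prime_elem (int p)" using assms by auto
  ultimately show ?thesis using x y assms
    by (simp add: rat_val_fraction prime_elem_multiplicity_mult_distrib del: of_int_mult)
qed

lemma rat_val_divide:
  assumes "prime p" "x \<noteq> 0" "y \<noteq> 0"
  shows "rat_val p (x / y) = rat_val p x - rat_val p y"
  using rat_val_mult[OF assms(1), of "x / y" y] assms by simp

lemma rat_val_power:
  assumes "prime p" "x \<noteq> 0"
  shows "rat_val p (x ^ n) = int n * rat_val p x"
  using assms by (induction n) (simp_all add: rat_val_mult rat_val_of_int[of p 1, simplified] algebra_simps)

lemma rat_val_prime:
  assumes "prime p"
  shows "rat_val p (of_nat p) = 1"
  using assms by (simp add: rat_val_of_nat)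

lemma rat_val_minus [simp]:
  assumes "prime p"
  shows "rat_val p (- x) = rat_val p x"
proof (cases "x = 0")
  case False
  have "rat_val p (-1) = 0"
    using rat_val_of_int[OF assms, of "-1"] by simp
  then show ?thesis using rat_val_mult[OF assms, of "-1" x] False by simp
qed simp

text \<open>
  The predicate says \<open>q \<in> p\<^sup>e \<int>\<^sub>(\<^sub>p\<^sub>)\<close>; zero has to be admitted separately because of the
  dummy value \<^prop>\<open>rat_val p 0 = 0\<close>.
\<close>

definition val_ge :: "nat \<Rightarrow> int \<Rightarrow> rat \<Rightarrow> bool" where
  "val_ge p e q \<longleftrightarrow> q = 0 \<or> e \<le> rat_val p q"

lemma val_ge_zero [simp]: "val_ge p e 0"
  by (simp add: val_ge_def)

lemma val_ge_mono: "val_ge p e q \<Longrightarrow> e' \<le> e \<Longrightarrow> val_ge p e' q"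
  by (auto simp: val_ge_def)

lemma val_ge_mult:
  assumes "prime p" "val_ge p e x" "val_ge p e' y"
  shows "val_ge p (e + e') (x * y)"
  using assms rat_val_mult[OF assms(1), of x y] by (cases "x = 0 \<or> y = 0") (auto simp: val_ge_def)

lemma val_ge_mult_left:
  assumes "prime p" "val_ge p 0 x" "val_ge p e y"
  shows "val_ge p e (x * y)"
  using val_ge_mult[OF assms] by simp

lemma val_ge_mult_right:
  assumes "prime p" "val_ge p e x" "val_ge p 0 y"
  shows "val_ge p e (x * y)"
  using val_ge_mult[OF assms] by simp

lemma val_ge_minus [simp]: "prime p \<Longrightarrow> val_ge p e (- x) \<longleftrightarrow> val_ge p e x"
  by (simp add: val_ge_def)

lemma val_ge_of_int: "prime p \<Longrightarrow> val_ge p 0 (of_int a)"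
  by (simp add: val_ge_def rat_val_of_int)

lemma val_ge_of_nat: "prime p \<Longrightarrow> val_ge p 0 (of_nat a)"
  by (simp add: val_ge_def rat_val_of_nat)

lemma val_ge_of_nat_dvd:
  assumes "prime p" "p dvd a"
  shows "val_ge p 1 (of_nat a)"
proof (cases "a = 0")
  case False
  then have "multiplicity p a \<ge> 1"
    using assms by (auto intro!: multiplicity_geI)
  then show ?thesis using assms by (simp add: val_ge_def rat_val_of_nat)
qed simp

lemma val_ge_add:
  assumes "prime p" "val_ge p e x" "val_ge p e y"
  shows "val_ge p e (x + y)"
proof (cases "x = 0 \<or> y = 0 \<or> x + y = 0")
  case False
  obtain a b where x: "x = of_int a / of_int b" "b \<noteq> 0" by (rule rat_fractionE)
  obtain c d where y: "y = of_int c / of_int d" "d \<noteq> 0" by (rule rat_fractionE)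
  let ?v = "\<lambda>z. int (multiplicity (int p) z)"
  have nz: "a \<noteq> 0" "c \<noteq> 0" using False x y by auto
  have sum: "x + y = of_int (a * d + c * b) / of_int (b * d)"
    using x y by (simp add: field_simps)
  have nz': "a * d + c * b \<noteq> 0" using False sum by (metis div_0 of_int_0)
  have v: "multiplicity (int p) (s * t) = multiplicity (int p) s + multiplicity (int p) t" if "s \<noteq> 0" "t \<noteq> 0" for s t
    using assms that by (simp add: prime_elem_multiplicity_mult_distrib)
  \<comment> \<open>Over the common denominator the numerator is a sum of two cross terms; p to the
    smaller of their multiplicities divides it.\<close>
  define m where "m = min (multiplicity (int p) (a * d)) (multiplicity (int p) (c * b))"
  have "int p ^ m dvd a * d + c * b"
    by (intro dvd_add multiplicity_dvd') (auto simp: m_def)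
  then have "m \<le> multiplicity (int p) (a * d + c * b)"
    using nz' assms by (intro multiplicity_geI) auto
  moreover have "e \<le> ?v a - ?v b" "e \<le> ?v c - ?v d"
    using assms nz x y False by (auto simp: val_ge_def rat_val_fraction)
  ultimately have "e \<le> ?v (a * d + c * b) - ?v (b * d)"
    using x y nz by (simp add: v m_def min_def split: if_splits)
  then show ?thesis using sum assms x y nz' unfolding val_ge_def
    by (auto simp: rat_val_fraction simp del: of_int_mult of_int_add)
qed (use assms in auto)

lemma val_ge_diff:
  assumes "prime p" "val_ge p e x" "val_ge p e y"
  shows "val_ge p e (x - y)"
  using val_ge_add[of p e x "- y"] assms by simp

lemma val_ge_sum:
  assumes "prime p" "\<And>i. i \<in> A \<Longrightarrow> val_ge p e (f i)"
  shows "val_ge p e (sum f A)"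
  using assms(2) by (induction A rule: infinite_finite_induct) (auto intro: val_ge_add assms)

text \<open>Ultrametric inequality: a difference of valuation above \<open>e\<close> cannot change
  whether a valuation is exactly \<open>e\<close>. Nonvanishing keeps out the dummy value at
  0.\<close>

lemma rat_val_eq_iff_congruent:
  assumes "prime p" "x \<noteq> 0" "y \<noteq> 0" "val_ge p (e + 1) (x - y)"
  shows "rat_val p x = e \<longleftrightarrow> rat_val p y = e"
proof -
  have *: "rat_val p y = e"
    if "rat_val p x = e" "val_ge p (e + 1) (x - y)" "x \<noteq> 0" "y \<noteq> 0" for x y
  proof -
    have "val_ge p e x" "val_ge p e (x - y)"
      using that by (auto simp: val_ge_def)
    then have "val_ge p e (x - (x - y))" using val_ge_diff assms by blast
    then have "e \<le> rat_val p y" using that by (simp add: val_ge_def)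
    have "\<not> val_ge p (e + 1) (y + (x - y))"
      using that by (simp add: val_ge_def)
    then have "\<not> val_ge p (e + 1) y" using that val_ge_add assms by blast
    then have "rat_val p y < e + 1" using that by (simp add: val_ge_def)
    with \<open>e \<le> rat_val p y\<close> show ?thesis by simp
  qed
  have "val_ge p (e + 1) (y - x)" using assms val_ge_minus[of p "e + 1" "x - y"] by simp
  then show ?thesis using * assms by blast
qed

lemma val_ge_unit:
  assumes "prime p" "\<not> p dvd a"
  shows "val_ge p e (of_nat a * x) \<longleftrightarrow> val_ge p e x"
proof -
  have "a \<noteq> 0" using assms by (metis dvd_0_right)
  moreover have "rat_val p (of_nat a) = 0"
    using assms by (simp add: rat_val_of_nat not_dvd_imp_multiplicity_0)
  ultimately show ?thesis using assms rat_val_mult[OF assms(1), of "of_nat a" x]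
    by (cases "x = 0") (auto simp: val_ge_def)
qed

subsection \<open>Legendre's formula\<close>

lemma digit_sum_rec:
  assumes "p > 1"
  shows "digit_sum p m = m mod p + digit_sum p (m div p)"
proof (cases "m = 0")
  case False
  then have lt: "m div p < m" using assms by simp
  have "digit_sum p m = m mod p + (\<Sum>i<m. m div p ^ Suc i mod p)"
    unfolding digit_sum_def by (simp add: sum.atMost_shift)
  also have "(\<Sum>i<m. m div p ^ Suc i mod p) = (\<Sum>i<m. (m div p) div p ^ i mod p)"
    by (simp add: div_mult2_eq)
  \<comment> \<open>The two digit sums have different bounds; the surplus terms vanish because
    \<open>m div p < i < p ^ i\<close>.\<close>
  also have "\<dots> = (\<Sum>i\<le>m div p. (m div p) div p ^ i mod p)"
  proof (rule sum.mono_neutral_right)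
    show "\<forall>i\<in>{..<m} - {..m div p}. m div p div p ^ i mod p = 0"
    proof
      fix i assume "i \<in> {..<m} - {..m div p}"
      then have "m div p < i" by auto
      also have "i < p ^ i" using assms by (simp add: power_gt_expt)
      finally show "m div p div p ^ i mod p = 0" by simp
    qed
  qed (use lt in auto)
  finally show ?thesis by (simp add: digit_sum_def)
qed (simp add: digit_sum_def)

text \<open>Carrying: with v = \<open>multiplicity p (Suc m)\<close>, adding 1 turns v trailing
  digits p - 1 into 0 and raises the next digit by 1.\<close>

lemma digit_sum_Suc:
  assumes "prime p"
  shows "digit_sum p (Suc m) + (p - 1) * multiplicity p (Suc m) = digit_sum p m + 1"
proof (induction m rule: less_induct)
  case (less m)
  have p: "p > 1" using assms prime_gt_1_nat by blast
  show ?case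
  proof (cases "p dvd Suc m")
    case False
    then have "Suc m div p = m div p" "Suc m mod p = Suc (m mod p)"
      using p by (auto simp: div_Suc mod_Suc dvd_eq_mod_eq_0 split: if_splits)
    then show ?thesis
      using digit_sum_rec[OF p, of m] digit_sum_rec[OF p, of "Suc m"]
        not_dvd_imp_multiplicity_0[OF False] by simp
  next
    case True
    then obtain q' where q': "Suc m = p * q'" by blast
    then obtain q where q: "q' = Suc q" by (cases q') auto
    have m: "m = p * q + (p - 1)" using q' q p by (simp add: algebra_simps)
    have "m div p = q" using p by (intro div_nat_eqI) (auto simp: m)
    moreover have "m mod p = p - 1"
      using mult_div_mod_eq[of p m] m unfolding \<open>m div p = q\<close> by linarith
    moreover have "Suc m div p = Suc q" "Suc m mod p = 0" using p q' q by auto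
    moreover have "multiplicity p (Suc m) = Suc (multiplicity p (Suc q))"
      using p assms unfolding q' q by (subst multiplicity_times_same) auto
    moreover have "1 * q \<le> p * q" using p by (intro mult_right_mono) auto
    then have "q < m" using m p by linarith
    moreover have "(p - 1) * Suc v = (p - 1) * v + (p - 1)" for v by simp
    ultimately show ?thesis
      using digit_sum_rec[OF p, of m] digit_sum_rec[OF p, of "Suc m"] less.IH[of q]
      by simp
  qed
qed

lemma legendre_digit_sum:
  assumes "prime p"
  shows "(p - 1) * multiplicity p (fact m :: nat) + digit_sum p m = m"
proof (induction m)
  case (Suc m)
  have "multiplicity p (fact (Suc m) :: nat) = multiplicity p (Suc m) + multiplicity p (fact m :: nat)"
    using assms by (simp add: prime_elem_multiplicity_mult_distrib del: mult_Suc)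
  then show ?case using Suc digit_sum_Suc[OF assms, of m] by (simp add: algebra_simps)
qed (simp add: digit_sum_def)

lemma rat_val_fact:
  assumes "prime p"
  shows "rat_of_int (rat_val p (fact m)) = (of_nat m - of_nat (digit_sum p m)) / (of_nat p - 1)"
proof -
  have p: "p > 1" using assms prime_gt_1_nat by blast
  have "rat_val p (fact m) = int (multiplicity p (fact m :: nat))"
    using rat_val_of_nat[OF assms, of "fact m"] by simp
  moreover have "rat_of_nat ((p - 1) * multiplicity p (fact m :: nat) + digit_sum p m) = rat_of_nat m"
    using legendre_digit_sum[OF assms, of m] by simp
  ultimately show ?thesis using p by (simp add: field_simps of_nat_diff)
qed

subsection \<open>Stirling numbers and Bernoulli polynomials of negative order\<close>

text \<open>Differentiating (e^t - 1)^k gives k((e^t - 1)^k + (e^t - 1)^(k-1)), which on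
  coefficients is the Stirling recurrence.\<close>

lemma Stirling_egf:
  "fps_nth ((fps_exp 1 - 1) ^ k) n = (fact k * of_nat (Stirling n k) / fact n :: rat)"
proof (induction n arbitrary: k)
  case 0
  show ?case by (cases k) auto
next
  case (Suc n)
  show ?case
  proof (cases k)
    case (Suc k')
    let ?E = "fps_exp 1 - 1 :: rat fps"
    have "fps_deriv (?E ^ Suc k') = of_nat (Suc k') * (?E ^ Suc k' + ?E ^ k')"
      unfolding fps_deriv_power
      by (simp add: algebra_simps fps_of_nat flip: fps_const_add)
    from arg_cong[OF this, of "\<lambda>F. fps_nth F n"]
    have "of_nat (Suc n) * fps_nth (?E ^ Suc k') (Suc n) =
        of_nat (Suc k') * (fps_nth (?E ^ Suc k') n + fps_nth (?E ^ k') n)"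
      by (simp only: fps_deriv_nth fps_mult_of_nat_nth fps_add_nth Suc_eq_plus1)
    then have "fps_nth (?E ^ Suc k') (Suc n) =
        of_nat (Suc k') * (fps_nth (?E ^ Suc k') n + fps_nth (?E ^ k') n) / of_nat (Suc n)"
      by (simp add: field_simps del: power_Suc of_nat_Suc)
    also have "\<dots> = fact (Suc k') * of_nat (Stirling (Suc n) (Suc k')) / fact (Suc n)"
      unfolding Suc.IH by (simp add: field_simps)
    finally show ?thesis using Suc by simp
  qed simp
qed

lemma Stirling_egf_shifted:
  "fps_nth ((fps_exp 1 - 1) ^ k * fps_exp 1) n =
    (fact k * of_nat (Stirling (Suc n) (Suc k)) / fact n :: rat)"
proof -
  have "(fps_exp 1 - 1) ^ k * fps_exp 1 =
      (fps_exp 1 - 1) ^ Suc k + (fps_exp 1 - 1 :: rat fps) ^ k"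
    by (simp add: algebra_simps)
  then show ?thesis unfolding fps_add_nth Stirling_egf
    by (simp add: Stirling_egf field_simps del: power_Suc)
qed

lemma bernoulli_base_powi_neg:
  "fps_X ^ k * bernoulli_base powi (- int k) = (fps_exp 1 - 1) ^ k"
proof -
  have "inverse bernoulli_base * bernoulli_base = 1"
    by (rule inverse_mult_eq_1) (simp add: bernoulli_base_nth_0)
  then have "fps_X * inverse bernoulli_base = fps_exp 1 - 1"
    using bernoulli_base_mult by (metis mult.assoc mult.commute mult_1)
  then show ?thesis
    by (auto simp: power_int_def power_mult_distrib[symmetric] bernoulli_base_nth_0)
qed

lemma poly_bernoulli_neg_order:
  assumes "k \<le> n"
  shows "poly (bernoulli_poly (- int k) (n - k)) x =
    fact (n - k) * fps_nth ((fps_exp 1 - 1) ^ k * fps_exp x) n"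
  using assms fps_X_power_mult_nth[of k "bernoulli_base powi (- int k) * fps_exp x" n]
  by (simp add: poly_bernoulli_poly flip: bernoulli_base_powi_neg mult.assoc)

lemma Stirling_eq_bernoulli_0:
  assumes "k \<le> n"
  shows "of_nat (Stirling n k) = of_nat (n choose k) * poly (bernoulli_poly (- int k) (n - k)) 0"
  using assms unfolding poly_bernoulli_neg_order[OF assms]
  by (simp add: Stirling_egf binomial_fact)

lemma Stirling_eq_bernoulli_1:
  assumes "k \<le> n"
  shows "of_nat (Stirling (Suc n) (Suc k)) =
    of_nat (n choose k) * poly (bernoulli_poly (- int k) (n - k)) 1"
  using assms unfolding poly_bernoulli_neg_order[OF assms]
  by (simp only: Stirling_egf_shifted) (simp add: binomial_fact)

section \<open>Expansion in the falling factorials (x - 1)(x - 2)...(x - m)\<close>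

definition falling_poly :: "nat \<Rightarrow> rat poly" where
  "falling_poly m = (\<Prod>i<m. [:- of_nat (Suc i), 1:])"

lemma poly_falling_poly: "poly (falling_poly m) (1 + x) = fact m * (x gchoose m)"
  by (simp add: falling_poly_def poly_prod gbinomial_prod_rev atLeast0LessThan)

lemma degree_falling_poly: "degree (falling_poly m) = m"
  unfolding falling_poly_def by (subst degree_prod_eq_sum_degree) auto

lemma lead_coeff_falling_poly: "lead_coeff (falling_poly m) = 1"
  unfolding falling_poly_def by (subst lead_coeff_prod) auto

text \<open>It suffices to compare both polynomials at the infinitely many points 1 + c with c
  natural, where e^(ct) = ((e^t - 1) + 1)^c expands binomially.\<close>

lemma bernoulli_falling_expansion:
  assumes "k \<le> n"
  shows "bernoulli_poly (- int k) (n - k) =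
    (\<Sum>m\<le>n - k. smult (fact (n - k) / fact m * fact (m + k) / fact n *
      of_nat (Stirling (Suc n) (Suc (m + k)))) (falling_poly m))" (is "?B = ?S")
proof -
  have eq: "poly ?B x = poly ?S x" if x: "x = 1 + of_nat c" for x :: rat and c :: nat
  proof -
  let ?E = "fps_exp 1 - 1 :: rat fps"
  let ?s = "\<lambda>m. of_nat (c choose m) * (fact (m + k) / fact n * of_nat (Stirling (Suc n) (Suc (m + k))) :: rat)"
  have "fps_exp (of_nat c :: rat) = (?E + 1) ^ c"
    by (simp add: fps_exp_power_mult)
  also have "\<dots> = (\<Sum>m\<le>c. of_nat (c choose m) * ?E ^ m)"
    unfolding binomial_ring by simp
  finally have "?E ^ k * fps_exp x = (\<Sum>m\<le>c. of_nat (c choose m) * (?E ^ (m + k) * fps_exp 1))"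
    unfolding x fps_exp_add_mult by (simp add: sum_distrib_left sum_distrib_right power_add algebra_simps)
  then have "poly ?B x = fact (n - k) * (\<Sum>m\<le>c. ?s m)"
    unfolding poly_bernoulli_neg_order[OF assms]
    by (simp add: fps_sum_nth fps_mult_of_nat_nth Stirling_egf_shifted)
  \<comment> \<open>Both bounds can be exchanged: \<open>c choose m\<close> vanishes for m > c, the
    Stirling number for m > n - k.\<close>
  also have "(\<Sum>m\<le>c. ?s m) = (\<Sum>m\<le>max c (n - k). ?s m)"
    by (rule sum.mono_neutral_left) auto
  also have "\<dots> = (\<Sum>m\<le>n - k. ?s m)"
    using assms by (intro sum.mono_neutral_right) auto
  also have "fact (n - k) * \<dots> = poly ?S x"
    by (simp add: x poly_sum poly_falling_poly sum_distrib_left binomial_gbinomial field_simps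
        del: Stirling.simps)
  finally show "poly ?B x = poly ?S x" .
  qed
  have "infinite (range (\<lambda>c::nat. 1 + of_nat c :: rat))"
    by (intro range_inj_infinite) (auto simp: inj_on_def)
  moreover have "range (\<lambda>c::nat. 1 + of_nat c) \<subseteq> {x. poly (?B - ?S) x = 0}"
    using eq by auto
  ultimately have "infinite {x. poly (?B - ?S) x = 0}" using infinite_super by blast
  then show ?thesis using poly_roots_finite[of "?B - ?S"] by auto
qed

subsection \<open>Powers of the logarithmic series\<close>

definition log_quot :: "rat fps" where
  "log_quot = Abs_fps (\<lambda>i. (-1) ^ i / of_nat (Suc i))"

text \<open>The second factor is the derivative of z L(z) = log(1 + z), hence 1/(1 + z).\<close>

lemma log_quot_ODE: "(1 + fps_X) * (log_quot + fps_X * fps_deriv log_quot) = 1"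
proof -
  have "log_quot + fps_X * fps_deriv log_quot = Abs_fps (\<lambda>i. (-1) ^ i)"
    unfolding fps_eq_iff
  proof
    fix i :: nat
    have "x / of_nat (Suc i) + of_nat i * (x / of_nat (Suc i)) = x" for x :: rat
      using of_nat_neq_0[of i] by (simp add: divide_simps del: of_nat_Suc) (simp add: algebra_simps)
    from this[of "(-1) ^ i"] show "fps_nth (log_quot + fps_X * fps_deriv log_quot) i = fps_nth (Abs_fps (\<lambda>i. (-1) ^ i)) i"
      by (cases i) (simp_all add: log_quot_def)
  qed
  moreover have "(1 + fps_X) * Abs_fps (\<lambda>i. (-1) ^ i :: rat) = 1"
    unfolding fps_eq_iff
  proof
    fix i show "fps_nth ((1 + fps_X) * Abs_fps (\<lambda>i. (-1) ^ i :: rat)) i = fps_nth 1 i"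
      by (cases i) (auto simp: distrib_right)
  qed
  ultimately show ?thesis by simp
qed

text \<open>Multiply the differential equation by n L^(-n-1); since (L^(-n))' = -n L^(-n-1) L', this
  expresses power n + 1 linearly through power n.\<close>

lemma log_quot_power_recursion:
  "of_nat n * inverse log_quot ^ Suc n =
    (1 + fps_X) * (of_nat n * inverse log_quot ^ n - fps_X * fps_deriv (inverse log_quot ^ n))"
proof -
  let ?I = "inverse log_quot"
  have 0: "fps_nth log_quot 0 \<noteq> 0" by (simp add: log_quot_def)
  then have I: "?I * log_quot = 1" by (rule inverse_mult_eq_1)
  have deriv: "fps_deriv (?I ^ n) = - of_nat n * ?I ^ Suc n * fps_deriv log_quot"
    unfolding fps_deriv_power fps_inverse_deriv[OF 0]
    by (cases n) (simp_all add: algebra_simps power2_eq_square fps_of_nat flip: fps_const_add)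
  have pow: "?I ^ n = ?I ^ Suc n * log_quot" using I by (simp add: algebra_simps)
  have "of_nat n * (?I ^ Suc n * log_quot) - fps_X * (- of_nat n * ?I ^ Suc n * fps_deriv log_quot) =
      of_nat n * ?I ^ Suc n * (log_quot + fps_X * fps_deriv log_quot)"
    by (simp add: algebra_simps del: power_Suc)
  then have "of_nat n * ?I ^ n - fps_X * fps_deriv (?I ^ n) =
      of_nat n * ?I ^ Suc n * (log_quot + fps_X * fps_deriv log_quot)"
    unfolding deriv pow[symmetric] .
  then show ?thesis
    using log_quot_ODE by (metis (no_types, lifting) mult.assoc mult.commute mult_1_right)
qed

text \<open>
  This replaces Lagrange inversion: both sides satisfy the recursion of the Stirling numbers.
\<close>

lemma log_quot_power_nth:
  assumes "j \<le> n"
  shows "fps_nth (inverse log_quot ^ Suc n) j =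
    fact (n - j) / fact n * of_nat (Stirling (Suc n) (Suc n - j))"
  using assms
proof (induction n arbitrary: j)
  case 0
  then show ?case by (simp add: log_quot_def)
next
  case (Suc n)
  let ?P = "\<lambda>n. inverse log_quot ^ n"
  \<comment> \<open>The coefficient of \<open>F\<close> at i is that of the old power times n + 1 -
    i; the factor 1 + z adds two neighbours, as in the Stirling recurrence.\<close>
  define F where "F = of_nat (Suc n) * ?P (Suc n) - fps_X * fps_deriv (?P (Suc n))"
  have F: "fps_nth F i = (of_nat (Suc n) - of_nat i) * fps_nth (?P (Suc n)) i" for i
    unfolding F_def by (cases i) (simp_all only: fps_sub_nth fps_mult_of_nat_nth fps_X_mult_nth
      fps_deriv_nth, simp_all add: algebra_simps del: power_Suc)
  have "of_nat (Suc n) * fps_nth (?P (Suc (Suc n))) j = fps_nth ((1 + fps_X) * F) j"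
    unfolding F_def log_quot_power_recursion[symmetric] by (simp only: fps_mult_of_nat_nth)
  also have "\<dots> = fps_nth F j + (if j = 0 then 0 else fps_nth F (j - 1))"
    by (simp add: distrib_right)
  finally have rec: "of_nat (Suc n) * fps_nth (?P (Suc (Suc n))) j =
      fps_nth F j + (if j = 0 then 0 else fps_nth F (j - 1))" .
  have "fps_nth F j + (if j = 0 then 0 else fps_nth F (j - 1)) =
      fact (Suc n - j) / fact n * of_nat (Stirling (Suc (Suc n)) (Suc (Suc n) - j))"
  proof (cases j)
    case 0
    then show ?thesis using Suc.IH[of 0] by (simp add: F del: power_Suc of_nat_Suc)
  next
    case (Suc i)
    have Fi: "fps_nth F i = of_nat (Suc n - i) * (fact (n - i) / fact n * of_nat (Stirling (Suc n) (Suc n - i)))"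
      using Suc.IH[of i] Suc Suc.prems by (simp add: F of_nat_diff del: power_Suc)
    show ?thesis
    proof (cases "j = Suc n")
      \<comment> \<open>The induction hypothesis does not reach index n + 1, but there the factor n
        + 1 - j in \<open>F\<close> is zero.\<close>
      case True
      then show ?thesis using Suc Fi by (simp add: F del: power_Suc)
    next
      case False
      then obtain d where n: "n = j + d" using Suc.prems le_Suc_ex by (metis le_SucE)
      have "fps_nth F j = of_nat (Suc d) * (fact d / fact n * of_nat (Stirling (Suc n) (Suc d)))"
        using Suc.IH[of j] by (simp add: F n del: power_Suc)
      moreover have "fps_nth F i =
          of_nat (Suc (Suc d)) * (fact (Suc d) / fact n * of_nat (Stirling (Suc n) (Suc (Suc d))))"
        using Fi by (simp add: n Suc del: Stirling.simps fact_Suc of_nat_Suc)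
      moreover have "Suc n - j = Suc d" "Suc (Suc n) - j = Suc (Suc d)" using n by auto
      ultimately show ?thesis
        using Suc by (simp add: algebra_simps add_divide_distrib del: Stirling.simps) (simp add: algebra_simps add_divide_distrib)
    qed
  qed
  with rec have "of_nat (Suc n) * fps_nth (?P (Suc (Suc n))) j =
      fact (Suc n - j) / fact n * of_nat (Stirling (Suc (Suc n)) (Suc (Suc n) - j))"
    by (rule trans)
  then show ?case by (simp add: eq_divide_eq mult.commute del: Stirling.simps power_Suc)
qed

definition falling_coeff :: "nat \<Rightarrow> nat \<Rightarrow> nat \<Rightarrow> rat" where
  "falling_coeff n k j = fact (n - k) / fact (n - k - j) * fps_nth (inverse log_quot ^ Suc n) j"

text \<open>For n = m + k + d, \<open>log_quot_power_nth\<close> identifies the Stirling factor at m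
  with the coefficient of L^(-n-1) at z^d, up to factorials.\<close>

lemma bernoulli_falling_coeff:
  assumes "k \<le> n"
  shows "bernoulli_poly (- int k) (n - k) =
    (\<Sum>m\<le>n - k. smult (falling_coeff n k (n - k - m)) (falling_poly m))"
  unfolding bernoulli_falling_expansion[OF assms] falling_coeff_def
proof (rule sum.cong)
  fix m assume "m \<in> {..n - k}"
  then have "m \<le> n - k" by simp
  then have "n = m + k + (n - k - m)" using assms by linarith
  then obtain d where d: "n = m + k + d" by blast
  have "n - d = m + k" "Suc n - d = Suc (m + k)" "n - k - m = d" "n - k - d = m" "d \<le> n"
    using d by auto
  then show "smult (fact (n - k) / fact m * fact (m + k) / fact n * of_nat (Stirling (Suc n) (Suc (m + k)))) (falling_poly m) =
    smult (fact (n - k) / fact (n - k - (n - k - m)) *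
      fps_nth (inverse log_quot ^ Suc n) (n - k - m)) (falling_poly m)"
    using log_quot_power_nth[of d n] by (simp only:) (simp only: times_divide_eq_left times_divide_eq_right mult.assoc)
qed simp

subsection \<open>Series with \<open>p\<close>-integral exponential coefficients\<close>

definition egf_coeff :: "rat fps \<Rightarrow> nat \<Rightarrow> rat" where
  "egf_coeff F a = fact a * fps_nth F a"

lemma egf_coeff_mult:
  "egf_coeff (F * G) a = (\<Sum>l\<le>a. of_nat (a choose l) * (egf_coeff F l * egf_coeff G (a - l)))"
  unfolding egf_coeff_def fps_mult_nth sum_distrib_left atLeast0AtMost
  by (rule sum.cong) (simp_all add: binomial_fact)

lemma egf_coeff_deriv: "egf_coeff (fps_deriv F) a = egf_coeff F (Suc a)"
  by (simp add: egf_coeff_def algebra_simps)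

definition egf_integral :: "nat \<Rightarrow> rat fps \<Rightarrow> bool" where
  "egf_integral p F \<longleftrightarrow> (\<forall>a. val_ge p 0 (egf_coeff F a))"

text \<open>
  The exponents \<open>a \<equiv> -1\<close> modulo \<open>p\<close> must be exempted: the regular part of \<open>log (1 + z) / z\<close> has
  exponential coefficient \<open>\<plusminus> a! / (a + 1)\<close>, a \<open>p\<close>-adic unit for example at \<open>a = 2p - 1\<close>.
\<close>

definition egf_flat :: "nat \<Rightarrow> rat fps \<Rightarrow> bool" where
  "egf_flat p F \<longleftrightarrow> (\<forall>a. val_ge p (if p \<le> a \<and> \<not> p dvd Suc a then 1 else 0) (egf_coeff F a))"

lemma egf_flat_imp_integral: "egf_flat p F \<Longrightarrow> egf_integral p F"
  unfolding egf_flat_def egf_integral_def by (auto intro!: val_ge_mono[where e' = 0])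

lemma prime_dvd_choose_of_Suc_dvd:
  assumes "prime (p :: nat)" "\<not> p dvd Suc a" "p dvd Suc l"
  shows "p dvd a choose l"
proof -
  have "Suc a * (a choose l) = Suc l * (Suc a choose Suc l)"
    by (simp only: Suc_times_binomial_eq mult.commute)
  then have "p dvd Suc a * (a choose l)" using assms by (simp only: dvd_mult2)
  then show ?thesis using assms prime_dvd_mult_nat by blast
qed

text \<open>p divides a! but neither l! nor (a - l)!.\<close>

lemma prime_dvd_choose_of_carry:
  assumes "prime (p :: nat)" "l \<le> a" "l < p" "a - l < p" "p \<le> a"
  shows "p dvd a choose l"
proof -
  have "p dvd fact l * fact (a - l) * (a choose l)"
    using assms by (simp only: binomial_fact_lemma prime_dvd_fact_iff)
  then show ?thesis using assms by (simp add: prime_dvd_mult_iff prime_dvd_fact_iff)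
qed

text \<open>One term of the binomial convolution. If p does not divide the binomial coefficient,
  neither l + 1 nor a - l + 1 is a multiple of p and one of l, a - l is at least p, so
  \<open>x\<close> or \<open>y\<close> supplies the factor p.\<close>

lemma egf_flat_term:
  assumes "prime p" "l \<le> a"
    and "val_ge p (if p \<le> l \<and> \<not> p dvd Suc l then 1 else 0) x"
    and "val_ge p (if p \<le> a - l \<and> \<not> p dvd Suc (a - l) then 1 else 0) y"
  shows "val_ge p (if p \<le> a \<and> \<not> p dvd Suc a then 1 else 0) (of_nat (a choose l) * (x * y))"
proof -
  have int: "val_ge p 0 x" "val_ge p 0 y"
    by (rule val_ge_mono[OF assms(3)], simp, rule val_ge_mono[OF assms(4)], simp)
  then have xy: "val_ge p 0 (x * y)" using assms(1) by (simp add: val_ge_mult_left)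
  have "val_ge p 1 (of_nat (a choose l) * (x * y))" if a: "p \<le> a" "\<not> p dvd Suc a"
  proof (cases "p dvd a choose l")
    case True
    then show ?thesis using assms(1) xy val_ge_mult_right val_ge_of_nat_dvd by blast
  next
    case False
    have "\<not> p dvd Suc l"
      using False a assms prime_dvd_choose_of_Suc_dvd by blast
    moreover have "\<not> p dvd Suc (a - l)"
      using False a assms prime_dvd_choose_of_Suc_dvd[of p a "a - l"] binomial_symmetric[of l a] by auto
    moreover have "p \<le> l \<or> p \<le> a - l"
      using False a assms prime_dvd_choose_of_carry[of p l a] by force
    ultimately have "val_ge p 1 x \<or> val_ge p 1 y" using assms by auto
    then have "val_ge p 1 (x * y)"
      using int assms(1) val_ge_mult_left val_ge_mult_right by blast
    then show ?thesis using assms(1) val_ge_mult_left val_ge_of_nat by blast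
  qed
  moreover have "val_ge p 0 (of_nat (a choose l) * (x * y))"
    using xy assms(1) by (simp add: val_ge_mult_left val_ge_of_nat)
  ultimately show ?thesis by simp
qed

lemma egf_integral_mult:
  assumes "prime p" "egf_integral p F" "egf_integral p G"
  shows "egf_integral p (F * G)"
  using assms unfolding egf_integral_def egf_coeff_mult
  by (auto intro!: val_ge_sum val_ge_mult_left val_ge_of_nat)

lemma egf_integral_deriv: "egf_integral p F \<Longrightarrow> egf_integral p (fps_deriv F)"
  by (simp add: egf_integral_def egf_coeff_deriv)

lemma egf_flat_mult:
  assumes "prime p" "egf_flat p F" "egf_flat p G"
  shows "egf_flat p (F * G)"
  using assms unfolding egf_flat_def egf_coeff_mult
  by (intro allI val_ge_sum egf_flat_term) auto

lemma egf_flat_1: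
  assumes "prime p"
  shows "egf_flat p 1"
  unfolding egf_flat_def
proof
  fix a show "val_ge p (if p \<le> a \<and> \<not> p dvd Suc a then 1 else 0) (egf_coeff 1 a)"
    using assms val_ge_of_nat[OF assms, of 1] prime_gt_0_nat[OF assms]
    by (cases "a = 0") (auto simp: egf_coeff_def)
qed

lemma egf_flat_power:
  assumes "prime p" "egf_flat p F"
  shows "egf_flat p (F ^ m)"
  using assms by (induction m) (simp_all add: egf_flat_1 egf_flat_mult)

text \<open>In the convolution for F F^(-1) = 1 the term l = 0 is the wanted coefficient; the others
  involve only smaller indices of the inverse.\<close>

lemma egf_flat_inverse:
  assumes "prime p" "egf_flat p F" "fps_nth F 0 = 1"
  shows "egf_flat p (inverse F)"
  unfolding egf_flat_def
proof
  fix a show "val_ge p (if p \<le> a \<and> \<not> p dvd Suc a then 1 else 0) (egf_coeff (inverse F) a)"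
  proof (induction a rule: less_induct)
    case (less a)
    let ?t = "\<lambda>l. of_nat (a choose l) * (egf_coeff F l * egf_coeff (inverse F) (a - l))"
    have "F * inverse F = 1" using assms inverse_mult_eq_1'[of F] by simp
    then have "egf_coeff 1 a = (\<Sum>l\<le>a. ?t l)" by (metis egf_coeff_mult)
    also have "\<dots> = ?t 0 + (\<Sum>l\<in>{..a} - {0}. ?t l)" by (rule sum.remove) auto
    finally have "egf_coeff (inverse F) a = egf_coeff 1 a - (\<Sum>l\<in>{..a} - {0}. ?t l)"
      using assms by (simp add: egf_coeff_def)
    moreover have "val_ge p (if p \<le> a \<and> \<not> p dvd Suc a then 1 else 0) (?t l)"
      if "l \<in> {..a} - {0}" for l
      using assms less[of "a - l"] that unfolding egf_flat_def by (intro egf_flat_term) auto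
    ultimately show ?case
      using assms egf_flat_1[OF assms(1)] unfolding egf_flat_def
      by (simp only:) (intro val_ge_diff val_ge_sum, auto)
  qed
qed

text \<open>Differentiation only shifts exponential coefficients, and it pulls the exponent m out of
  the power. For m = 0 the truncated m - 1 is harmless because of this factor.\<close>

lemma egf_coeff_power_Suc:
  assumes "prime p" "egf_flat p F"
  obtains x where "val_ge p 0 x" "egf_coeff (F ^ m) (Suc a) = of_nat m * x"
proof
  have "egf_integral p (F ^ (m - 1) * fps_deriv F)"
    using assms by (intro egf_integral_mult egf_integral_deriv egf_flat_imp_integral egf_flat_power)
  then show "val_ge p 0 (egf_coeff (F ^ (m - 1) * fps_deriv F) a)"
    by (simp add: egf_integral_def)
  have "fps_deriv (F ^ m) = fps_const (of_nat m) * (F ^ (m - 1) * fps_deriv F)"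
    by (simp add: fps_deriv_power mult_ac)
  then show "egf_coeff (F ^ m) (Suc a) = of_nat m * egf_coeff (F ^ (m - 1) * fps_deriv F) a"
    unfolding egf_coeff_deriv[symmetric] by (simp add: egf_coeff_def)
qed

subsection \<open>Separating the polar term of the logarithmic series\<close>

definition log_quot_reg :: "nat \<Rightarrow> rat fps" where
  "log_quot_reg p = Abs_fps (\<lambda>i. if i = p - 1 then 0 else (-1) ^ i / of_nat (Suc i))"

text \<open>Oddness makes the sign (-1)^(p-1) of the separated term positive.\<close>

lemma log_quot_decompose:
  assumes "odd p"
  shows "log_quot = log_quot_reg p + fps_const (1 / of_nat p) * fps_X ^ (p - 1)"
proof -
  have "Suc (p - 1) = p" "even (p - 1)" using assms odd_pos by (simp, simp)
  then show ?thesis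
    unfolding fps_eq_iff log_quot_def log_quot_reg_def by (auto simp: fps_X_power_nth simp del: of_nat_Suc)
qed

text \<open>Hence a!/(a + 1) is p-integral except at a = p - 1. With l + 1 = p c, the factors p and
  c both occur in l!, distinct unless c = p. Oddness matters: 4 does not divide 3!.\<close>

lemma Suc_dvd_fact:
  assumes "prime p" "odd p" "p dvd Suc l" "Suc l \<noteq> p"
  shows "Suc l dvd fact l"
proof -
  obtain c where c: "Suc l = p * c" using assms by blast
  have p: "p \<ge> 3"
    using assms prime_ge_2_nat[OF assms(1)] by (cases "p = 2") auto
  have c1: "c \<noteq> 0" "c \<noteq> 1" using c assms by (metis mult_0_right Zero_not_Suc, auto)
  have sub: "\<Prod>A dvd (fact l :: nat)" if "A \<subseteq> {1..l}" for A
    unfolding fact_prod of_nat_id by (rule prod_dvd_prod_subset) (use that in auto)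
  show ?thesis
  proof (cases "c = p")
    \<comment> \<open>For l + 1 = p^2 the factors p and 2p are both available, since 2p <
      p^2.\<close>
    case True
    have "3 * p \<le> p * p" using p by (intro mult_right_mono) auto
    moreover have "Suc l = p * p" using c True by simp
    ultimately have "2 * p \<le> l" using p by linarith
    then have "\<Prod>{p, 2 * p} dvd (fact l :: nat)" using p by (intro sub) auto
    then have "p * (2 * p) dvd (fact l :: nat)" using p by simp
    then show ?thesis unfolding c True by (meson dvd_trans dvd_triv_right mult_dvd_mono dvd_refl)
  next
    case False
    have "2 * p \<le> c * p" "c * 3 \<le> c * p" using p c1 by (intro mult_mono; simp)+
    moreover have "Suc l = c * p" using c by simp
    ultimately have "p \<le> l" "c \<le> l" using p c1 by linarith+
    then have "\<Prod>{p, c} dvd (fact l :: nat)" using p c1 by (intro sub) auto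
    then show ?thesis using False unfolding c by simp
  qed
qed

text \<open>If p divides a + 1, integrality suffices. Otherwise a + 1 is a unit, and a! contains p
  as soon as a \<ge> p.\<close>

lemma egf_flat_log_quot_reg:
  assumes "prime p" "odd p"
  shows "egf_flat p (log_quot_reg p)"
  unfolding egf_flat_def
proof
  fix a
  let ?e = "if p \<le> a \<and> \<not> p dvd Suc a then 1 else 0 :: int"
  have "val_ge p ?e (fact a / of_nat (Suc a))" if ne: "Suc a \<noteq> p"
  proof (cases "p dvd Suc a")
    case True
    then obtain c where "fact a = Suc a * c" using Suc_dvd_fact[OF assms True ne] by blast
    then have "(fact a :: rat) / of_nat (Suc a) = of_nat c"
      by (metis of_nat_fact of_nat_mult nonzero_mult_div_cancel_left of_nat_neq_0)
    then show ?thesis using True assms val_ge_of_nat by simp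
  next
    case False
    have "val_ge p ?e (of_nat (fact a))"
      using assms val_ge_of_nat[OF assms(1)] val_ge_of_nat_dvd[OF assms(1), of "fact a"]
      by (simp add: prime_dvd_fact_iff del: of_nat_fact)
    also have "of_nat (fact a) = of_nat (Suc a) * (fact a / of_nat (Suc a) :: rat)"
      by (simp del: of_nat_Suc)
    finally show ?thesis using val_ge_unit[OF assms(1) False] by metis
  qed
  moreover have "egf_coeff (log_quot_reg p) a = (if Suc a = p then 0 else (-1) ^ a * (fact a / of_nat (Suc a)))"
    using assms by (auto simp: egf_coeff_def log_quot_reg_def)
  moreover have "(-1 :: rat) ^ a = 1 \<or> (-1 :: rat) ^ a = -1"
    by (cases "even a") auto
  ultimately show "val_ge p ?e (egf_coeff (log_quot_reg p) a)"
    using assms by (auto simp del: of_nat_Suc)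
qed

text \<open>W^i has order at least i, so the composition can be truncated at j uniformly in all
  coefficients up to j.\<close>

lemma fps_mult_compose_nth:
  fixes A B W :: "'a :: comm_ring_1 fps"
  assumes "fps_nth W 0 = 0"
  shows "fps_nth (A * (B oo W)) j = (\<Sum>i\<le>j. fps_nth B i * fps_nth (A * W ^ i) j)"
proof -
  have "fps_nth (B oo W) l = (\<Sum>i\<le>j. fps_nth B i * fps_nth (W ^ i) l)" if "l \<le> j" for l
    unfolding fps_compose_nth
    using that assms by (intro sum.mono_neutral_left) (auto simp: startsby_zero_power_prefix)
  then have "fps_nth (A * (B oo W)) j =
      (\<Sum>l\<le>j. \<Sum>i\<le>j. fps_nth B i * (fps_nth (W ^ i) l * fps_nth A (j - l)))"
    unfolding mult.commute[of A] fps_mult_nth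
    by (auto simp: atLeast0AtMost sum_distrib_right mult.assoc intro!: sum.cong)
  also have "\<dots> = (\<Sum>i\<le>j. fps_nth B i * fps_nth (W ^ i * A) j)"
    by (subst sum.swap) (simp add: fps_mult_nth sum_distrib_left atLeast0AtMost)
  finally show ?thesis by (simp add: mult.commute)
qed

text \<open>Write G + H = G (1 + W) with W = H/G and substitute W into the binomial series of
  exponent -m.\<close>

lemma inverse_power_add_nth:
  fixes G H :: "rat fps"
  assumes "fps_nth G 0 = 1" "fps_nth H 0 = 0"
  shows "fps_nth (inverse (G + H) ^ m) j =
    (\<Sum>i\<le>j. (- of_nat m gchoose i) * fps_nth (H ^ i * inverse G ^ (m + i)) j)"
proof -
  let ?W = "H * inverse G"
  have W: "fps_nth ?W 0 = 0" using assms by simp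
  have "G * inverse G = 1" using assms inverse_mult_eq_1'[of G] by simp
  then have "G + H = G * (1 + ?W)" by (simp add: distrib_left mult.left_commute)
  then have "inverse (G + H) ^ m = inverse G ^ m * inverse ((1 + ?W) ^ m)"
    by (simp add: fps_inverse_mult power_mult_distrib fps_inverse_power)
  also have "inverse ((1 + ?W) ^ m) = fps_binomial (- of_nat m) oo ?W"
    unfolding fps_binomial_minus_of_nat using W
    by (subst fps_inverse_compose)
      (simp_all add: fps_nth_power_0 fps_compose_power[symmetric] fps_compose_add_distrib)
  finally show ?thesis
    by (simp add: fps_mult_compose_nth[OF W] power_mult_distrib power_add mult_ac)
qed

subsection \<open>Maximum poles in the falling factorial basis\<close>

lemma val_ge_coeff_falling_poly:
  assumes "prime p"
  shows "val_ge p 0 (coeff (falling_poly m) i)"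
proof (induction m arbitrary: i)
  case 0
  then show ?case using val_ge_of_nat[OF assms, of 1] by (simp add: falling_poly_def)
next
  case (Suc m)
  have "coeff (falling_poly (Suc m)) i =
      (case i of 0 \<Rightarrow> 0 | Suc i' \<Rightarrow> coeff (falling_poly m) i') - of_nat (Suc m) * coeff (falling_poly m) i"
    by (cases i) (simp_all add: falling_poly_def del: of_nat_Suc)
  then show ?case using Suc assms
    by (cases i) (auto simp del: of_nat_Suc intro!: val_ge_diff val_ge_mult_left val_ge_of_nat)
qed

text \<open>Each basis polynomial is monic with p-integral coefficients, so the coordinates can be
  peeled off from the top degree.\<close>

lemma val_ge_falling_coords:
  assumes "prime p" "\<And>i. val_ge p e (coeff (\<Sum>m\<le>N. smult (d m) (falling_poly m)) i)" "m \<le> N"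
  shows "val_ge p e (d m)"
  using assms(2,3)
proof (induction N)
  case 0
  from 0(1)[of 0] 0(2) show ?case by (simp add: falling_poly_def)
next
  case (Suc N)
  let ?f = "\<lambda>N. \<Sum>m\<le>N. smult (d m) (falling_poly m)"
  have "coeff (?f N) (Suc N) = 0"
    by (auto simp: coeff_sum degree_falling_poly coeff_eq_0 intro!: sum.neutral)
  moreover have "coeff (falling_poly (Suc N)) (Suc N) = 1"
    using lead_coeff_falling_poly[of "Suc N"] by (simp add: degree_falling_poly)
  ultimately have top: "val_ge p e (d (Suc N))"
    using Suc.prems(1)[of "Suc N"] by simp
  have "val_ge p e (coeff (?f N) i)" for i
  proof -
    have "val_ge p e (coeff (?f (Suc N)) i - d (Suc N) * coeff (falling_poly (Suc N)) i)"
      using Suc.prems(1) top assms(1)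
      by (intro val_ge_diff val_ge_mult_right val_ge_coeff_falling_poly)
    then show ?thesis by simp
  qed
  then show ?case using Suc top by (metis le_Suc_eq)
qed

text \<open>The basis change preserves the bound \<open>e\<close> in one direction and, by
  \<open>val_ge_falling_coords\<close>, the bound \<open>e + 1\<close> in the other.\<close>

lemma max_pole_falling_sum:
  assumes "prime p" "\<And>m. m \<le> N \<Longrightarrow> val_ge p e (d m)" "l \<le> N" "\<not> val_ge p (e + 1) (d l)"
  shows "max_pole p (\<Sum>m\<le>N. smult (d m) (falling_poly m)) = - e" (is "max_pole p ?f = _")
proof -
  have ge: "val_ge p e (coeff ?f i)" for i
    using assms val_ge_coeff_falling_poly[OF assms(1)]
    by (auto simp: coeff_sum intro!: val_ge_sum val_ge_mult_right)
  obtain i where i: "\<not> val_ge p (e + 1) (coeff ?f i)"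
    using val_ge_falling_coords[OF assms(1), where e = "e + 1" and N = N and d = d and m = l] assms
    by blast
  let ?S = "{rat_val p (coeff ?f i) | i. coeff ?f i \<noteq> 0}"
  have "?S \<subseteq> (\<lambda>i. rat_val p (coeff ?f i)) ` {..degree ?f}"
    using le_degree by blast
  then have "finite ?S" by (rule finite_subset) simp
  moreover have "e \<in> ?S"
  proof -
    have "coeff ?f i \<noteq> 0" "rat_val p (coeff ?f i) = e"
      using i ge[of i] by (auto simp: val_ge_def)
    then show ?thesis by blast
  qed
  moreover have "e \<le> v" if "v \<in> ?S" for v
    using that ge by (auto simp: val_ge_def)
  ultimately have "Min ?S = e" by (intro Min_eqI) auto
  then show ?thesis by (simp add: max_pole_def)
qed

subsection \<open>Contributions of the part \<open>p - 1\<close>\<close>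

text \<open>
  \<open>tau_part p n k i\<close> comes from the partition with \<open>u\<^sub>p\<^sub>-\<^sub>1 = i\<close> as only nonzero part, of weight
  \<open>i (p - 1) \<le> n - k\<close>; for \<open>i = r\<close> it is \<open>\<tau>\<^sub>u\<close>.
\<close>

definition tau_part :: "nat \<Rightarrow> nat \<Rightarrow> nat \<Rightarrow> nat \<Rightarrow> rat" where
  "tau_part p n k i = fact (n - k) / fact (n - k - i * (p - 1)) *
     (- of_nat (Suc n) gchoose i) / of_nat p ^ i"

text \<open>The factor beside t_i in D_j: \<open>Y\<close> is the degree left after i parts p - 1,
  and \<open>a = j - i * (p - 1)\<close>.\<close>

definition cofactor :: "nat \<Rightarrow> nat \<Rightarrow> nat \<Rightarrow> nat \<Rightarrow> nat \<Rightarrow> rat" where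
  "cofactor p n Y i a = of_nat (Y choose a) * egf_coeff (inverse (log_quot_reg p) ^ (Suc n + i)) a"

lemma log_quot_reg_nth_0: "odd p \<Longrightarrow> prime p \<Longrightarrow> fps_nth (log_quot_reg p) 0 = 1"
  using prime_gt_1_nat[of p] by (simp add: log_quot_reg_def)

lemma gbinomial_minus_of_nat_Suc:
  "(- of_nat (Suc n) gchoose i) = ((-1) ^ i * of_nat (n + i choose i) :: rat)"
proof -
  have "of_nat (Suc n) + of_nat i - 1 = (of_nat (n + i) :: rat)" by simp
  then show ?thesis unfolding gbinomial_minus binomial_gbinomial by simp
qed

locale bernoulli_setting =
  fixes p n k r :: nat
  assumes prime: "prime p" and odd: "odd p" and kn: "k \<le> n" and N: "n - k = r * (p - 1)"
begin

abbreviation t :: "nat \<Rightarrow> rat" where "t \<equiv> tau_part p n k"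

lemma p_ge_3: "p \<ge> 3"
  using prime odd prime_ge_2_nat[of p] by (cases "p = 2") auto

lemma flat: "egf_flat p (inverse (log_quot_reg p))"
  using prime odd by (intro egf_flat_inverse egf_flat_log_quot_reg log_quot_reg_nth_0)

lemma falling_coeff_expansion:
  assumes "j \<le> n - k"
  shows "falling_coeff n k j = (\<Sum>i\<le>r. if i * (p - 1) \<le> j
    then t i * cofactor p n ((r - i) * (p - 1)) i (j - i * (p - 1)) else 0)"
proof -
  let ?J = "inverse (log_quot_reg p)"
  let ?H = "fps_const (1 / of_nat p) * fps_X ^ (p - 1) :: rat fps"
  have H: "fps_nth ?H 0 = 0" using p_ge_3 by simp
  have summand: "fact (n - k) / fact (n - k - j) * ((- of_nat (Suc n) gchoose i) *
        fps_nth (?H ^ i * ?J ^ (Suc n + i)) j) =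
      (if i * (p - 1) \<le> j
        then t i * cofactor p n ((r - i) * (p - 1)) i (j - i * (p - 1)) else 0)" for i
  proof -
    have "?H ^ i * ?J ^ (Suc n + i) =
        fps_const ((1 / of_nat p) ^ i) * (fps_X ^ (i * (p - 1)) * ?J ^ (Suc n + i))"
      by (simp add: power_mult_distrib fps_const_power power_mult[symmetric] mult_ac)
    then have nth: "fps_nth (?H ^ i * ?J ^ (Suc n + i)) j = (1 / of_nat p) ^ i *
        (if i * (p - 1) \<le> j then fps_nth (?J ^ (Suc n + i)) (j - i * (p - 1)) else 0)"
      by (simp only: fps_mult_left_const_nth fps_X_power_mult_nth not_le[symmetric] if_not_P) auto
    show ?thesis
    proof (cases "i * (p - 1) \<le> j")
      case True
      define s where "s = i * (p - 1)"
      \<comment> \<open>N!/(N - j)! splits into N!/(N - s)!, which belongs to \<open>t i\<close>,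
        and a falling factorial equal to (j - s)! times a binomial coefficient.\<close>
      have Y: "(r - i) * (p - 1) = n - k - s" by (simp add: N s_def diff_mult_distrib)
      have "n - k - s - (j - s) = n - k - j" "j - s \<le> n - k - s"
        using True assms unfolding s_def by simp_all
      then have choose: "of_nat (n - k - s choose (j - s)) =
          (fact (n - k - s) / (fact (j - s) * fact (n - k - j)) :: rat)"
        by (simp only: binomial_fact)
      show ?thesis using True[folded s_def]
        unfolding nth tau_part_def cofactor_def egf_coeff_def s_def[symmetric] Y choose
        by (simp add: power_divide del: power_Suc add_Suc of_nat_Suc)
    next
      case False
      then show ?thesis unfolding nth by simp
    qed
  qed
  have "falling_coeff n k j = (\<Sum>i\<le>j. fact (n - k) / fact (n - k - j) * ((- of_nat (Suc n) gchoose i) *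
        fps_nth (?H ^ i * ?J ^ (Suc n + i)) j))"
    unfolding falling_coeff_def log_quot_decompose[OF odd]
    by (subst inverse_power_add_nth[OF log_quot_reg_nth_0[OF odd prime] H])
      (simp only: sum_distrib_left)
  also have "\<dots> = (\<Sum>i\<le>j. if i * (p - 1) \<le> j
    then t i * cofactor p n ((r - i) * (p - 1)) i (j - i * (p - 1)) else 0)"
    by (intro sum.cong refl summand)
  \<comment> \<open>This index set lies in both ranges: i \<le> i(p - 1) \<le> j, and j \<le> r(p -
    1) forces i \<le> r.\<close>
  also have "\<dots> = (\<Sum>i\<in>{i. i * (p - 1) \<le> j}. t i * cofactor p n ((r - i) * (p - 1)) i (j - i * (p - 1)))"
  proof (rule sum.mono_neutral_cong_right)
    have "i * 1 \<le> i * (p - 1)" for i using p_ge_3 by (intro mult_le_mono2) linarith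
    then show "{i. i * (p - 1) \<le> j} \<subseteq> {..j}"
      unfolding mult_1_right using le_trans by blast
  qed auto
  also have "\<dots> = (\<Sum>i\<le>r. if i * (p - 1) \<le> j
    then t i * cofactor p n ((r - i) * (p - 1)) i (j - i * (p - 1)) else 0)"
  proof (rule sum.mono_neutral_cong_left)
    show "{i. i * (p - 1) \<le> j} \<subseteq> {..r}"
    proof
      fix i assume "i \<in> {i. i * (p - 1) \<le> j}"
      then have "i * (p - 1) \<le> r * (p - 1)"
        using assms unfolding N mem_Collect_eq by (rule le_trans)
      then show "i \<in> {..r}" using p_ge_3 by simp
    qed
  qed auto
  finally show ?thesis .
qed

lemma t_neq_0: "t i \<noteq> 0"
  unfolding tau_part_def gbinomial_minus_of_nat_Suc using p_ge_3 by simp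

lemma cofactor_integral: "val_ge p 0 (cofactor p n Y i a)"
  using prime egf_flat_imp_integral[OF egf_flat_power[OF prime flat]]
  unfolding cofactor_def egf_integral_def by (intro val_ge_mult_left val_ge_of_nat) blast+

text \<open>The binomial ratio is -(n + 1 + i)/(i + 1) and the factorials contribute p - 1
  consecutive integers. Denominators stay cleared since p may divide i + 1.\<close>

lemma t_Suc:
  assumes "i < r"
  shows "of_nat (Suc i) * of_nat p * t (Suc i) =
    - (of_nat (\<Prod>{Suc ((r - Suc i) * (p - 1))..(r - i) * (p - 1)}) * (of_nat (Suc n + i) * t i))"
proof -
  define Y where "Y = (r - Suc i) * (p - 1)"
  have "r - i = Suc (r - Suc i)" using assms by simp
  then have Y: "(r - i) * (p - 1) = Y + (p - 1)" by (simp add: Y_def)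
  define P where "P = \<Prod>{Suc Y..Y + (p - 1)}"
  have fact: "(fact (Y + (p - 1)) :: rat) = fact Y * of_nat P"
    using fact_eq_fact_times[of Y "Y + (p - 1)"] unfolding P_def by (metis le_add1 of_nat_fact of_nat_mult)
  have P: "of_nat P \<noteq> (0 :: rat)" unfolding P_def of_nat_eq_0_iff by simp
  have sub: "n - k - i * (p - 1) = Y + (p - 1)" "n - k - Suc i * (p - 1) = Y"
    using Y unfolding N Y_def by (simp_all only: diff_mult_distrib)
  let ?g = "\<lambda>i. (- of_nat (Suc n) :: rat) gchoose i"
  have g: "of_nat (Suc i) * ?g (Suc i) = - (of_nat (Suc n + i) * ?g i)"
    using gbinomial_mult_1[of "- of_nat (Suc n) :: rat" i] by (simp add: algebra_simps)
  have "of_nat (Suc i) * of_nat p * t (Suc i) =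
      fact (n - k) / fact Y * (of_nat (Suc i) * ?g (Suc i)) / of_nat p ^ i"
    unfolding tau_part_def sub using p_ge_3 by (simp del: of_nat_Suc)
  also have "\<dots> = - (of_nat P * (of_nat (Suc n + i) * t i))"
    unfolding tau_part_def sub fact g using P by (simp del: of_nat_Suc)
  finally show ?thesis unfolding Y P_def Y_def .
qed

lemma not_dvd_prod_interval:
  assumes "p dvd Suc (Y + (p - 1))"
  shows "\<not> p dvd \<Prod>{Suc Y..Y + (p - 1)}"
proof
  assume "p dvd \<Prod>{Suc Y..Y + (p - 1)}"
  then have "\<exists>x\<in>{Suc Y..Y + (p - 1)}. p dvd x"
    by (rule prime_dvd_prod_iff[OF finite_atLeastAtMost prime, THEN iffD1])
  then obtain x where x: "p dvd x" "Suc Y \<le> x" "x \<le> Y + (p - 1)"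
    by (meson atLeastAtMost_iff)
  have "p dvd Suc (Y + (p - 1)) - x" using x assms by (intro dvd_diff_nat)
  moreover have "0 < Suc (Y + (p - 1)) - x" "Suc (Y + (p - 1)) - x < p" using x p_ge_3 by auto
  ultimately show False using nat_dvd_not_less by blast
qed

section \<open>Congruences modulo p^(e+1) for a common lower bound e of the valuations\<close>

context
  fixes e :: int
  assumes t_ge: "\<And>i. i \<le> r \<Longrightarrow> val_ge p e (t i)"
begin

text \<open>The p - 1 integers in the ratio t_(i+1)/t_i lie just below a multiple of p, so their
  product is a unit and can be cancelled.\<close>

lemma t_next_gain:
  assumes "i < r" "p dvd Suc ((r - i) * (p - 1))"
  shows "val_ge p (e + 1) (of_nat (Suc n + i) * t i)"
proof -
  define Y where "Y = (r - Suc i) * (p - 1)"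
  have "r - i = Suc (r - Suc i)" using assms by simp
  then have Y: "(r - i) * (p - 1) = Y + (p - 1)" by (simp add: Y_def)
  have "val_ge p (1 + e) (of_nat p * t (Suc i))"
    using assms by (intro val_ge_mult val_ge_of_nat_dvd prime t_ge) auto
  then have "val_ge p (1 + e) (of_nat (Suc i) * of_nat p * t (Suc i))"
    unfolding mult.assoc by (rule val_ge_mult_left[OF prime val_ge_of_nat[OF prime]])
  then have "val_ge p (1 + e) (of_nat (\<Prod>{Suc Y..Y + (p - 1)}) * (of_nat (Suc n + i) * t i))"
    unfolding t_Suc[OF assms(1)] Y Y_def[symmetric] by (simp only: val_ge_minus[OF prime])
  moreover have "\<not> p dvd \<Prod>{Suc Y..Y + (p - 1)}"
    using not_dvd_prod_interval[of Y] assms(2) unfolding Y .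
  ultimately have "val_ge p (1 + e) (of_nat (Suc n + i) * t i)"
    using val_ge_unit[OF prime] by blast
  then show ?thesis unfolding add.commute[of 1 e] .
qed

text \<open>
  The only use of \<open>\<nu>\<^sub>p(k) \<le> \<nu>\<^sub>p(n)\<close>: since \<open>n + r = k + r p\<close>, it forces
  \<open>\<nu>\<^sub>p(n + r) = \<nu>\<^sub>p(k) \<le> \<nu>\<^sub>p(r)\<close>, and the ratio of the last two leading terms is, up to a unit,
  \<open>(n + r) / (r p)\<close>.
\<close>

lemma t_before_last_gain:
  assumes "multiplicity p k \<le> multiplicity p n" "1 \<le> k" "r = Suc i"
  shows "val_ge p (e + 1) (t i)"
proof -
  let ?v = "multiplicity p k"
  have nr: "n + r = k + r * p"
    using kn N p_ge_3 by (cases p) auto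
  have coprime: "coprime (p ^ ?v) (p - 1)"
    using p_ge_3 prime by (intro coprime_power_left_iff[THEN iffD2] disjI1) (metis coprime_Suc_left_nat Suc_pred' prime_gt_0_nat)
  have "p ^ ?v dvd n - k"
    using assms by (intro dvd_diff_nat multiplicity_dvd' multiplicity_dvd) auto
  then have "p ^ ?v dvd r" using coprime unfolding N by (simp add: coprime_dvd_mult_left_iff)
  then have vr: "?v \<le> multiplicity p r"
    using assms prime by (intro multiplicity_geI) auto
  have "multiplicity p (n + r) < Suc ?v"
  proof (rule multiplicity_lessI)
    show "\<not> p ^ Suc ?v dvd n + r"
    proof
      assume "p ^ Suc ?v dvd n + r"
      moreover have "p ^ Suc ?v dvd r * p"
        using \<open>p ^ ?v dvd r\<close> by (simp add: mult.commute mult_dvd_mono)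
      ultimately have "p ^ Suc ?v dvd k" using nr by (simp add: dvd_add_left_iff)
      then have "Suc ?v \<le> ?v" using assms prime by (intro multiplicity_geI) auto
      then show False by simp
    qed
  qed (use assms prime in auto)
  then have quot: "val_ge p 0 (of_nat r / of_nat (n + r))"
    using vr prime assms by (simp add: val_ge_def rat_val_divide rat_val_of_nat del: of_nat_add of_nat_Suc)
  have "val_ge p (1 + e) (of_nat p * t r)"
    using t_ge prime by (intro val_ge_mult val_ge_of_nat_dvd) auto
  from val_ge_mult_left[OF prime quot this]
  have "val_ge p (e + 1) (of_nat r / of_nat (n + r) * (of_nat p * t r))"
    by (simp only: add.commute)
  \<comment> \<open>At i = r - 1 the factors i + 1 and n + 1 + i of \<open>t_Suc\<close> are r and n
    + r, and the interval is 1, ..., p - 1.\<close>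
  also have "of_nat r / of_nat (n + r) * (of_nat p * t r) = - (of_nat (\<Prod>{Suc 0..p - 1}) * t i)"
    using t_Suc[of i] assms by (simp add: field_simps del: of_nat_prod)
  finally have "val_ge p (e + 1) (of_nat (\<Prod>{Suc 0..p - 1}) * t i)"
    by (simp only: val_ge_minus[OF prime])
  moreover have "\<not> p dvd \<Prod>{Suc 0..p - 1}"
    using not_dvd_prod_interval[of 0] p_ge_3 unfolding add_0 by auto
  ultimately show ?thesis using val_ge_unit[OF prime] by blast
qed

lemma falling_coeff_ge:
  assumes "j \<le> n - k"
  shows "val_ge p e (falling_coeff n k j)"
  unfolding falling_coeff_expansion[OF assms]
  using t_ge prime cofactor_integral by (auto intro!: val_ge_sum val_ge_mult_right)

text \<open>At j = i(p - 1) later parts are absent, earlier ones vanish modulo p^(e+1), and the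
  cofactor of \<open>t i\<close> is 1: nothing cancels it.\<close>

lemma falling_coeff_first_min:
  assumes "i \<le> r" "\<And>i'. i' < i \<Longrightarrow> val_ge p (e + 1) (t i')" "rat_val p (t i) = e"
  shows "\<not> val_ge p (e + 1) (falling_coeff n k (i * (p - 1)))"
proof -
  let ?j = "i * (p - 1)"
  let ?u = "\<lambda>i'. if i' * (p - 1) \<le> ?j
    then t i' * cofactor p n ((r - i') * (p - 1)) i' (?j - i' * (p - 1)) else 0"
  have "?j \<le> n - k" unfolding N using assms(1) by (rule mult_right_mono) simp
  then have "falling_coeff n k ?j = (\<Sum>i'\<le>r. ?u i')" by (rule falling_coeff_expansion)
  also have "\<dots> = ?u i + (\<Sum>i'\<in>{..r} - {i}. ?u i')"
    using assms by (intro sum.remove) auto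
  also have "?u i = t i"
    using log_quot_reg_nth_0[OF odd prime] by (simp add: cofactor_def egf_coeff_def fps_nth_power_0)
  finally have eq: "t i = falling_coeff n k ?j - (\<Sum>i'\<in>{..r} - {i}. ?u i')" by simp
  have rest: "val_ge p (e + 1) (\<Sum>i'\<in>{..r} - {i}. ?u i')"
  proof (intro val_ge_sum prime)
    fix i' assume "i' \<in> {..r} - {i}"
    then consider "i' < i" | "i < i'" by fastforce
    then show "val_ge p (e + 1) (?u i')"
    proof cases
      case 1
      then show ?thesis using assms prime cofactor_integral by (auto intro!: val_ge_mult_right)
    next
      case 2
      then show ?thesis using p_ge_3 by simp
    qed
  qed
  show ?thesis
  proof
    assume "val_ge p (e + 1) (falling_coeff n k ?j)"
    with rest have "val_ge p (e + 1) (t i)" unfolding eq using prime by (intro val_ge_diff)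
    then show False using assms t_neq_0 by (simp add: val_ge_def)
  qed
qed

lemma falling_coeff_near_top:
  assumes "multiplicity p k \<le> multiplicity p n" "1 \<le> k" "b < p" "b \<le> n - k"
  shows "val_ge p (e + 1) (falling_coeff n k (n - k - b) - (if b = 0 then t r else 0))"
proof -
  let ?j = "n - k - b"
  let ?u = "\<lambda>i. if i * (p - 1) \<le> ?j
    then t i * cofactor p n ((r - i) * (p - 1)) i (?j - i * (p - 1)) else 0"
  have "r * (p - 1) \<le> ?j \<longleftrightarrow> b = 0" using assms(4) unfolding N by linarith
  then have "?u r = (if b = 0 then t r else 0)"
    using log_quot_reg_nth_0[OF odd prime]
    by (simp add: N cofactor_def egf_coeff_def fps_nth_power_0)
  moreover have "falling_coeff n k ?j = (\<Sum>i\<in>insert r {..<r}. ?u i)"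
    unfolding falling_coeff_expansion[OF diff_le_self] by (rule sum.cong) auto
  ultimately have eq: "falling_coeff n k ?j - (if b = 0 then t r else 0) = (\<Sum>i<r. ?u i)"
    by simp
  show ?thesis unfolding eq
  proof (intro val_ge_sum prime)
    fix i assume "i \<in> {..<r}"
    then have i: "i < r" by simp
    define Y where "Y = (r - i) * (p - 1)"
    define a where "a = ?j - i * (p - 1)"
    have "r * (p - 1) = i * (p - 1) + Y"
      using i unfolding Y_def by (metis add_mult_distrib le_add_diff_inverse less_imp_le)
    then have a: "a = Y - b" unfolding a_def N by simp
    have "val_ge p (e + 1) (t i * cofactor p n Y i a)"
    proof (cases "r = Suc i")
      case True
      then show ?thesis
        using t_before_last_gain assms prime cofactor_integral by (intro val_ge_mult_right)
    next
      case False
      \<comment> \<open>Now a = Y - b \<ge> p - 1 > 0, so the derivative argument applies to the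
        coefficient at a; the boundary case a = p - 1 has p dividing a + 1.\<close>
      then have "2 * (p - 1) \<le> Y" unfolding Y_def using i by (intro mult_right_mono) auto
      then have a_ge: "p - 1 \<le> a" "a \<le> Y" using a assms by auto
      then obtain a' where a': "a = Suc a'" using p_ge_3 by (cases a) auto
      show ?thesis
      proof (cases "p dvd Suc Y")
        case True
        obtain x where x: "val_ge p 0 x"
            "egf_coeff (inverse (log_quot_reg p) ^ (Suc n + i)) a = of_nat (Suc n + i) * x"
          using egf_coeff_power_Suc[OF prime flat] a' by metis
        have "val_ge p 0 (of_nat (Y choose a) * x)"
          by (rule val_ge_mult_left[OF prime val_ge_of_nat[OF prime] x(1)])
        from val_ge_mult_right[OF prime t_next_gain[OF i True[unfolded Y_def]] this]
        have "val_ge p (e + 1) (of_nat (Suc n + i) * t i * (of_nat (Y choose a) * x))" .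
        then show ?thesis unfolding cofactor_def x by (simp only: mult_ac)
      next
        case notY: False
        have flat_a: "val_ge p (if p \<le> a \<and> \<not> p dvd Suc a then 1 else 0)
            (egf_coeff (inverse (log_quot_reg p) ^ (Suc n + i)) a)"
          using egf_flat_power[OF prime flat] unfolding egf_flat_def by blast
        have "val_ge p 1 (cofactor p n Y i a)"
        proof (cases "p dvd Suc a")
          case True
          then have "p dvd Y choose a" using notY prime prime_dvd_choose_of_Suc_dvd by blast
          then show ?thesis using flat_a True prime unfolding cofactor_def
            by (simp add: val_ge_mult_right val_ge_of_nat_dvd)
        next
          case False
          then have "a \<noteq> p - 1" using p_ge_3 by auto
          then have "p \<le> a" using a_ge by simp
          then show ?thesis using flat_a False prime unfolding cofactor_def
            by (simp add: val_ge_mult_left val_ge_of_nat)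
        qed
        then show ?thesis using t_ge[of i] i prime by (intro val_ge_mult) auto
      qed
    qed
    then show "val_ge p (e + 1) (?u i)" by (simp add: a_def Y_def)
  qed
qed

end

end

section \<open>The maximum pole and the values at 0 and 1\<close>

context bernoulli_setting
begin

abbreviation B :: "rat poly" where "B \<equiv> bernoulli_poly (- int k) (n - k)"

lemma max_pole_eq_min_tau_part:
  obtains e where "max_pole p B = - e" "\<And>i. i \<le> r \<Longrightarrow> val_ge p e (t i)"
proof
  define e where "e = Min ((\<lambda>i. rat_val p (t i)) ` {..r})"
  have min: "e \<le> rat_val p (t i)" if "i \<le> r" for i
    using that by (simp add: e_def)
  then show ge: "val_ge p e (t i)" if "i \<le> r" for i
    using that by (simp add: val_ge_def)
  have "e \<in> (\<lambda>i. rat_val p (t i)) ` {..r}"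
    unfolding e_def by (rule Min_in) auto
  then have ex: "\<exists>i. i \<le> r \<and> rat_val p (t i) = e" by auto
  \<comment> \<open>The least index attaining the minimum is taken, so that all earlier t_i have
    valuation at least \<open>e + 1\<close>.\<close>
  define i where "i = (LEAST i. i \<le> r \<and> rat_val p (t i) = e)"
  have i: "i \<le> r" "rat_val p (t i) = e" using LeastI_ex[OF ex] by (simp_all add: i_def)
  have less: "val_ge p (e + 1) (t i')" if "i' < i" for i'
    using not_less_Least[OF that[unfolded i_def]] min[of i'] that i by (auto simp: val_ge_def)
  have le: "i * (p - 1) \<le> n - k" unfolding N using i(1) by (rule mult_right_mono) simp
  show "max_pole p B = - e"
    unfolding bernoulli_falling_coeff[OF kn]
  proof (rule max_pole_falling_sum[OF prime])
    show "\<not> val_ge p (e + 1) (falling_coeff n k (n - k - (n - k - i * (p - 1))))"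
      unfolding diff_diff_cancel[OF le] by (rule falling_coeff_first_min[OF ge i(1) less i(2)])
  qed (use falling_coeff_ge[OF ge] in auto)
qed

lemma bernoulli_1_congruent:
  assumes "\<And>i. i \<le> r \<Longrightarrow> val_ge p e (t i)" "multiplicity p k \<le> multiplicity p n" "1 \<le> k"
  shows "val_ge p (e + 1) (poly B 1 - t r)"
proof -
  have "poly (falling_poly m) 1 = (if m = 0 then 1 else 0)" for m
    using poly_falling_poly[of m 0] by (cases m) auto
  then have "poly B 1 = falling_coeff n k (n - k)"
    unfolding bernoulli_falling_coeff[OF kn] by (simp add: poly_sum mult_delta_right)
  then show ?thesis
    using falling_coeff_near_top[OF assms, of 0] p_ge_3 by simp
qed

text \<open>The basis polynomials take the values (-1)^m m! at 0. Terms with m < p are near the top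
  degree; for m \<ge> p the factorial supplies the extra p.\<close>

lemma bernoulli_0_congruent:
  assumes "\<And>i. i \<le> r \<Longrightarrow> val_ge p e (t i)" "multiplicity p k \<le> multiplicity p n" "1 \<le> k"
  shows "val_ge p (e + 1) (poly B 0 - t r)"
proof -
  let ?q = "\<lambda>m. poly (falling_poly m) 0"
  have q: "?q m = of_int ((- 1) ^ m * fact m)" for m
    by (induction m) (simp_all add: falling_poly_def algebra_simps)
  have "poly B 0 - t r =
      (\<Sum>m\<le>n - k. falling_coeff n k (n - k - m) * ?q m) - (\<Sum>m\<le>n - k. if m = 0 then t r else 0)"
    unfolding bernoulli_falling_coeff[OF kn] by (simp add: poly_sum)
  also have "\<dots> = (\<Sum>m\<le>n - k. falling_coeff n k (n - k - m) * ?q m - (if m = 0 then t r else 0))"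
    by (simp only: sum_subtractf)
  also have "val_ge p (e + 1) \<dots>"
  proof (intro val_ge_sum prime)
    fix m assume "m \<in> {..n - k}"
    then have m: "m \<le> n - k" by simp
    show "val_ge p (e + 1) (falling_coeff n k (n - k - m) * ?q m - (if m = 0 then t r else 0))"
    proof (cases "m < p")
      case True
      have factor: "falling_coeff n k (n - k - m) * ?q m - (if m = 0 then t r else 0) =
          (falling_coeff n k (n - k - m) - (if m = 0 then t r else 0)) * ?q m"
        by (simp add: q)
      show ?thesis unfolding factor unfolding q
        by (rule val_ge_mult_right[OF prime falling_coeff_near_top[OF assms True m] val_ge_of_int[OF prime]])
    next
      case False
      have "val_ge p 1 (of_nat (fact m))"
        using False prime by (intro val_ge_of_nat_dvd) (simp_all add: prime_dvd_fact_iff)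
      then have "val_ge p (0 + 1) (of_int ((- 1) ^ m) * of_nat (fact m))"
        by (intro val_ge_mult val_ge_of_int prime)
      moreover have "of_int ((- 1) ^ m) * of_nat (fact m) = ?q m" by (simp add: q)
      ultimately have "val_ge p 1 (?q m)" by simp
      then have "val_ge p (e + 1) (falling_coeff n k (n - k - m) * ?q m)"
        using falling_coeff_ge[OF assms(1), of "n - k - m"] prime by (intro val_ge_mult) auto
      then show ?thesis using False p_ge_3 by simp
    qed
  qed
  finally show ?thesis .
qed

lemma t_last_eq_tau: "t r = tau p n k r"
proof -
  have "- of_nat (Suc n) = (- of_nat n - 1 :: rat)" by simp
  then show ?thesis unfolding tau_part_def tau_def by (simp only:) (simp add: N)
qed

text \<open>Legendre gives (n - k)! the valuation r - \<open>digit_sum p (n - k)\<close> / (p - 1),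
  and the denominator p^r cancels r.\<close>

lemma rat_val_t_last:
  "rat_of_int (rat_val p (t r)) =
    of_nat (multiplicity p (r + n choose n)) - of_nat (digit_sum p (n - k)) / (of_nat p - 1)"
proof -
  have p1: "of_nat p - (1 :: rat) \<noteq> 0" using p_ge_3 by simp
  have choose: "n + r choose r = (r + n choose n)"
    using binomial_symmetric[of r "n + r"] by (simp add: add.commute)
  have "t r = fact (n - k) * ((-1) ^ r * of_nat (r + n choose n)) / of_nat p ^ r"
    unfolding tau_part_def gbinomial_minus_of_nat_Suc choose by (simp add: N)
  moreover have "rat_val p ((-1) ^ r * of_nat (r + n choose n)) = int (multiplicity p (r + n choose n))"
    using prime by (cases "even r") (simp_all add: rat_val_of_nat)
  ultimately have "rat_val p (t r) =
      rat_val p (fact (n - k)) + int (multiplicity p (r + n choose n)) - int r"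
    using prime p_ge_3 by (simp add: rat_val_divide rat_val_mult rat_val_power rat_val_prime)
  moreover have "rat_of_nat (n - k) = of_nat r * (of_nat p - 1)"
    using p_ge_3 by (simp add: N of_nat_diff)
  ultimately show ?thesis
    using p1 by (simp add: rat_val_fact[OF prime] diff_divide_distrib)
qed

end

lemma Stirling_pos: "1 \<le> k \<Longrightarrow> k \<le> n \<Longrightarrow> Stirling n k > 0"
proof (induction n arbitrary: k)
  case (Suc n)
  then show ?case by (cases k; cases "k = Suc n") auto
qed simp

lemma rat_val_choose:
  assumes "prime p" "k \<le> n"
  shows "rat_of_nat (multiplicity p (n choose k)) =
    (of_nat (digit_sum p k) + of_nat (digit_sum p (n - k)) - of_nat (digit_sum p n)) / (of_nat p - 1)"
proof -
  have "rat_val p (of_nat (n choose k)) =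
      rat_val p (fact n) - (rat_val p (fact k) + rat_val p (fact (n - k)))"
    unfolding binomial_fact[OF assms(2)] using assms by (simp add: rat_val_divide rat_val_mult)
  from arg_cong[OF this, of rat_of_int] show ?thesis
    using assms by (simp add: rat_val_fact rat_val_of_nat of_nat_diff flip: diff_divide_distrib add_divide_distrib)
qed

theorem theorem3p6:
  fixes p n k r :: nat and M :: int
  assumes "prime p" and "odd p"
    and "1 \<le> k" and "k \<le> n"
    and "multiplicity p k \<le> multiplicity p n"
    and "n - k = r * (p - 1)"
    and "M = max_pole p (bernoulli_poly (- int k) (n - k))"
  shows "(AMZC p n k \<longleftrightarrow> SAMZC p (n + 1) (k + 1))
    \<and> (AMZC p n k \<longleftrightarrow>
         rat_of_nat (multiplicity p ((r + n) choose n)) =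
         rat_of_nat (digit_sum p (n - k)) / (rat_of_nat p - 1) - rat_of_int M)
    \<and> (AMZC p n k \<longleftrightarrow> rat_val p (tau p n k r) = - M)
    \<and> (AMZC p n k \<longrightarrow>
         multiplicity p (Stirling (n + 1) (k + 1)) = multiplicity p (Stirling n k)
       \<and> rat_of_nat (multiplicity p (Stirling n k)) =
           (rat_of_nat (digit_sum p k) - rat_of_nat (digit_sum p n)) / (rat_of_nat p - 1)
           + rat_of_nat (multiplicity p ((r + n) choose n)))"
proof -
  interpret bernoulli_setting p n k r
    using assms by unfold_locales
  obtain e where e: "max_pole p B = - e" "\<And>i. i \<le> r \<Longrightarrow> val_ge p e (t i)"
    by (rule max_pole_eq_min_tau_part) blast
  have M: "M = - e" using e(1) assms(7) by simp
  have S0: "of_nat (Stirling n k) = of_nat (n choose k) * poly B 0"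
    and S1: "of_nat (Stirling (n + 1) (k + 1)) = of_nat (n choose k) * poly B 1"
    using Stirling_eq_bernoulli_0[OF kn] Stirling_eq_bernoulli_1[OF kn] by simp_all
  have "Stirling n k > 0" "Stirling (n + 1) (k + 1) > 0"
    using assms by (intro Stirling_pos; simp)+
  then have nz: "poly B 0 \<noteq> 0" "poly B 1 \<noteq> 0"
    using S0 S1 by (metis mult_zero_right of_nat_eq_0_iff less_irrefl)+
  have nzc: "(of_nat (n choose k) :: rat) \<noteq> 0" using kn by simp
  have v0: "int (multiplicity p (Stirling n k)) = int (multiplicity p (n choose k)) + rat_val p (poly B 0)"
    using arg_cong[OF S0, of "rat_val p"] unfolding rat_val_mult[OF prime nzc nz(1)]
    by (simp only: rat_val_of_nat[OF prime])
  have v1: "int (multiplicity p (Stirling (n + 1) (k + 1))) =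
      int (multiplicity p (n choose k)) + rat_val p (poly B 1)"
    using arg_cong[OF S1, of "rat_val p"] unfolding rat_val_mult[OF prime nzc nz(2)]
    by (simp only: rat_val_of_nat[OF prime])
  have "rat_val p (poly B 0) = e \<longleftrightarrow> rat_val p (t r) = e"
    using bernoulli_0_congruent[OF e(2) assms(5,3)] nz t_neq_0 prime
    by (intro rat_val_eq_iff_congruent) auto
  then have A: "AMZC p n k \<longleftrightarrow> rat_val p (t r) = e"
    unfolding AMZC_def using v0 e(1) by auto
  have eq1: "rat_val p (poly B 1) = e \<longleftrightarrow> rat_val p (t r) = e"
    using bernoulli_1_congruent[OF e(2) assms(5,3)] nz t_neq_0 prime
    by (intro rat_val_eq_iff_congruent) auto
  \<comment> \<open>Shifting both indices by 1 gives order -(k + 1) + 1 = -k and the same binomial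
    coefficient, hence the same maximum pole M.\<close>
  then have SA: "SAMZC p (n + 1) (k + 1) \<longleftrightarrow> rat_val p (t r) = e"
    unfolding SAMZC_def using v1 e(1) by auto
  have C: "rat_val p (t r) = e \<longleftrightarrow>
      rat_of_nat (multiplicity p ((r + n) choose n)) =
      rat_of_nat (digit_sum p (n - k)) / (rat_of_nat p - 1) - rat_of_int M"
  proof -
    have "rat_val p (t r) = e \<longleftrightarrow> rat_of_int (rat_val p (t r)) = rat_of_int e" by simp
    then show ?thesis unfolding rat_val_t_last M by auto
  qed
  have "multiplicity p (Stirling (n + 1) (k + 1)) = multiplicity p (Stirling n k) \<and>
      rat_of_nat (multiplicity p (Stirling n k)) =
        (rat_of_nat (digit_sum p k) - rat_of_nat (digit_sum p n)) / (rat_of_nat p - 1)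
        + rat_of_nat (multiplicity p ((r + n) choose n))" if "rat_val p (t r) = e"
  proof
    have "int (multiplicity p (Stirling n k)) = int (multiplicity p (n choose k)) + rat_val p (t r)"
      using v0 A that e(1) unfolding AMZC_def by simp
    \<comment> \<open>The digit sum of n - k cancels between the binomial coefficient and
      \<open>t r\<close>.\<close>
    from arg_cong[OF this, of rat_of_int]
    show "rat_of_nat (multiplicity p (Stirling n k)) =
        (rat_of_nat (digit_sum p k) - rat_of_nat (digit_sum p n)) / (rat_of_nat p - 1)
        + rat_of_nat (multiplicity p ((r + n) choose n))"
      using rat_val_choose[OF prime kn] rat_val_t_last
      by (simp add: add_divide_distrib diff_divide_distrib)
    show "multiplicity p (Stirling (n + 1) (k + 1)) = multiplicity p (Stirling n k)"
      using v0 v1 A eq1 that e(1) unfolding AMZC_def by simp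
  qed
  then show ?thesis using A SA C M t_last_eq_tau by simp
qed

end
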